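(* Let $(\Xi,\rho,\theta,\Sigma)$ be a continuous groupoid action with $\Xi$ strongly non-compact, and let $\Sigma_{\rm nw}\subset\Sigma$ be the set of its non-wandering points. The set $\Sigma_{\rm nw}$ is closed. If the groupoid $\Xi$ is open and locally compact, $\Sigma_{\rm nw}$ is also invariant.
   Context: All topological spaces are Hausdorff. A groupoid $\Xi$ is a small category in which all arrows are invertible; $X=\Xi^{(0)}$ is its unit space, $d,r:\Xi\to X$ are the source and range maps, and $\xi\eta$ is defined iff $d(\xi)=r(\eta)$. A topological groupoid is a groupoid with a (Hausdorff) topology making inversion and multiplication continuous (composable pairs carry the topology induced from $\Xi\times\Xi$); $X$ has the subspace topology. $\Xi$ is called open if $d:\Xi\to X$ is an open map. For $x\in X$, $\Xi_x=d^{-1}(\{x\})$. $\Xi$ is strongly non-compact if $\Xi_x$ is non-compact for every $x\in X$. A continuous groupoid action $(\Xi,\rho,\theta,\Sigma)$ consists of a topological groupoid $\Xi$, a Hausdorff space $\Sigma$, a continuous surjection $\rho:\Sigma\to X$ (the anchor) and a continuous map $\theta:\{(\xi,\sigma)\in\Xi\times\Sigma: d(\xi)=\rho(\sigma)\}\to\Sigma$, $\theta_\xi(\sigma)=\xi\bullet\sigma$, with $\rho(\sigma)\bullet\sigma=\sigma$ and: if $d(\xi)=r(\eta)$ and $d(\eta)=\rho(\sigma)$ then $d(\xi)=\rho(\eta\bullet\sigma)$ and $(\xi\eta)\bullet\sigma=\xi\bullet(\eta\bullet\sigma)$. For $M\subset\Sigma$, $\xi\bullet M=\{\xi\bullet\sigma:\sigma\in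 M,\ \rho(\sigma)=d(\xi)\}$. $M$ is invariant if $\xi\bullet M\subset M$ for all $\xi\in\Xi$. The recurrence set is $\widetilde\Xi_M^N=\{\xi\in\Xi:(\xi\bullet M)\cap N\neq\emptyset\}$ for $M,N\subset\Sigma$. A point $\sigma\in\Sigma$ is wandering if it has a neighborhood $W$ such that $\widetilde\Xi_W^W$ is relatively compact (has compact closure) in $\Xi$; otherwise it is non-wandering. *)

theory Defs
  imports "HOL-Analysis.Analysis"
begin

text \<open>
  Groupoids are presented by their arrows: \<open>G\<close> is the set of arrows, the unit space \<open>X \<subseteq> G\<close> is
  the set of identity arrows, \<open>d\<close> and \<open>r\<close> are the source and range maps, and \<open>mult \<xi> \<eta>\<close> is only
  meaningful when \<open>d \<xi> = r \<eta>\<close>.  The operations are total functions whose values outside the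
  stated domains are irrelevant.
\<close>

locale arrow_groupoid =
  fixes G :: "'g set" and X :: "'g set"
    and d r :: "'g \<Rightarrow> 'g"
    and mult :: "'g \<Rightarrow> 'g \<Rightarrow> 'g"
    and ginv :: "'g \<Rightarrow> 'g"
  assumes units_subset: "X \<subseteq> G"
    and source_unit: "\<xi> \<in> G \<Longrightarrow> d \<xi> \<in> X"
    and range_unit: "\<xi> \<in> G \<Longrightarrow> r \<xi> \<in> X"
    and source_of_unit: "x \<in> X \<Longrightarrow> d x = x"
    and range_of_unit: "x \<in> X \<Longrightarrow> r x = x"
    and mult_closed: "\<xi> \<in> G \<Longrightarrow> \<eta> \<in> G \<Longrightarrow> d \<xi> = r \<eta> \<Longrightarrow> mult \<xi> \<eta> \<in> G"
    and source_mult: "\<xi> \<in> G \<Longrightarrow> \<eta> \<in> G \<Longrightarrow> d \<xi> = r \<eta> \<Longrightarrow> d (mult \<xi> \<eta>) = d \<eta>"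
    and range_mult: "\<xi> \<in> G \<Longrightarrow> \<eta> \<in> G \<Longrightarrow> d \<xi> = r \<eta> \<Longrightarrow> r (mult \<xi> \<eta>) = r \<xi>"
    and mult_assoc: "\<xi> \<in> G \<Longrightarrow> \<eta> \<in> G \<Longrightarrow> \<zeta> \<in> G \<Longrightarrow> d \<xi> = r \<eta> \<Longrightarrow> d \<eta> = r \<zeta> \<Longrightarrow>
          mult (mult \<xi> \<eta>) \<zeta> = mult \<xi> (mult \<eta> \<zeta>)"
    and mult_left_unit: "\<xi> \<in> G \<Longrightarrow> mult (r \<xi>) \<xi> = \<xi>"
    and mult_right_unit: "\<xi> \<in> G \<Longrightarrow> mult \<xi> (d \<xi>) = \<xi>"
    and inv_closed: "\<xi> \<in> G \<Longrightarrow> ginv \<xi> \<in> G"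
    and source_inv: "\<xi> \<in> G \<Longrightarrow> d (ginv \<xi>) = r \<xi>"
    and range_inv: "\<xi> \<in> G \<Longrightarrow> r (ginv \<xi>) = d \<xi>"
    and mult_inv_left: "\<xi> \<in> G \<Longrightarrow> mult (ginv \<xi>) \<xi> = d \<xi>"
    and mult_inv_right: "\<xi> \<in> G \<Longrightarrow> mult \<xi> (ginv \<xi>) = r \<xi>"

locale topological_groupoid = arrow_groupoid "topspace T" X d r mult ginv
  for T :: "'g topology" and X :: "'g set"
    and d r :: "'g \<Rightarrow> 'g" and mult :: "'g \<Rightarrow> 'g \<Rightarrow> 'g" and ginv :: "'g \<Rightarrow> 'g" +
  assumes Hausdorff_groupoid: "Hausdorff_space T"
    and continuous_inv: "continuous_map T T ginv"
    and continuous_mult: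
      "continuous_map (subtopology (prod_topology T T) {(\<xi>, \<eta>). d \<xi> = r \<eta>}) T
         (\<lambda>(\<xi>, \<eta>). mult \<xi> \<eta>)"
begin

definition open_groupoid :: bool where
  "open_groupoid \<longleftrightarrow> open_map T (subtopology T X) d"

definition strongly_noncompact :: bool where
  "strongly_noncompact \<longleftrightarrow> (\<forall>x\<in>X. \<not> compactin T {\<xi> \<in> topspace T. d \<xi> = x})"

definition relatively_compact :: "'g set \<Rightarrow> bool" where
  "relatively_compact A \<longleftrightarrow> compactin T (T closure_of A)"

end

locale continuous_groupoid_action = topological_groupoid T X d r mult ginv
  for T :: "'g topology" and X :: "'g set"
    and d r :: "'g \<Rightarrow> 'g" and mult :: "'g \<Rightarrow> 'g \<Rightarrow> 'g" and ginv :: "'g \<Rightarrow> 'g" +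
  fixes \<rho> :: "'s \<Rightarrow> 'g" and \<theta> :: "'g \<Rightarrow> 's \<Rightarrow> 's" and S :: "'s topology"
  assumes Hausdorff_action: "Hausdorff_space S"
    and continuous_anchor: "continuous_map S (subtopology T X) \<rho>"
    and surj_anchor: "\<rho> ` topspace S = X"
    and continuous_action:
      "continuous_map (subtopology (prod_topology T S) {(\<xi>, \<sigma>). d \<xi> = \<rho> \<sigma>}) S
         (\<lambda>(\<xi>, \<sigma>). \<theta> \<xi> \<sigma>)"
    and action_unit: "\<sigma> \<in> topspace S \<Longrightarrow> \<theta> (\<rho> \<sigma>) \<sigma> = \<sigma>"
    and anchor_action: "\<xi> \<in> topspace T \<Longrightarrow> \<eta> \<in> topspace T \<Longrightarrow> \<sigma> \<in> topspace S \<Longrightarrow>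
          d \<xi> = r \<eta> \<Longrightarrow> d \<eta> = \<rho> \<sigma> \<Longrightarrow> d \<xi> = \<rho> (\<theta> \<eta> \<sigma>)"
    and action_mult: "\<xi> \<in> topspace T \<Longrightarrow> \<eta> \<in> topspace T \<Longrightarrow> \<sigma> \<in> topspace S \<Longrightarrow>
          d \<xi> = r \<eta> \<Longrightarrow> d \<eta> = \<rho> \<sigma> \<Longrightarrow> \<theta> (mult \<xi> \<eta>) \<sigma> = \<theta> \<xi> (\<theta> \<eta> \<sigma>)"
begin

definition translate :: "'g \<Rightarrow> 's set \<Rightarrow> 's set" where
  "translate \<xi> M = {\<theta> \<xi> \<sigma> |\<sigma>. \<sigma> \<in> M \<and> \<rho> \<sigma> = d \<xi>}"

definition invariant :: "'s set \<Rightarrow> bool" where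
  "invariant M \<longleftrightarrow> (\<forall>\<xi>\<in>topspace T. translate \<xi> M \<subseteq> M)"

definition recurrence_set :: "'s set \<Rightarrow> 's set \<Rightarrow> 'g set" where
  "recurrence_set M N = {\<xi> \<in> topspace T. translate \<xi> M \<inter> N \<noteq> {}}"

text \<open>A neighbourhood is a set containing an open set around the point; it need not be open.\<close>

definition wandering :: "'s \<Rightarrow> bool" where
  "wandering \<sigma> \<longleftrightarrow>
     (\<exists>W. W \<subseteq> topspace S \<and> (\<exists>V. openin S V \<and> \<sigma> \<in> V \<and> V \<subseteq> W) \<and>
          relatively_compact (recurrence_set W W))"

definition nonwandering_set :: "'s set" where
  "nonwandering_set = {\<sigma> \<in> topspace S. \<not> wandering \<sigma>}"

end

end

theory Submission
  imports Defs
begin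

text \<open>
  Shrinking a neighbourhood shrinks its recurrence set, and in a Hausdorff space a subset of a
  compact set is relatively compact.  So an open neighbourhood that witnesses that one point is
  wandering does so for all of its points; the wandering points form an open set, and
  \<open>nonwandering_set\<close> is closed.

  Invariance is proved in the form: if \<open>\<tau> = \<theta> \<xi> \<sigma>\<close> is wandering, so is \<open>\<sigma>\<close>.  Let \<open>V\<close> be an open
  neighbourhood of \<open>\<tau>\<close> with relatively compact recurrence.  Continuity of the action and local
  compactness give an open \<open>A\<close> around \<open>\<xi>\<close>, contained in a compact \<open>K\<close>, and an open \<open>U\<close> around \<open>\<sigma>\<close>
  with \<open>A \<bullet> U \<subseteq> V\<close>.  As \<open>d\<close> is open, the anchor can be kept inside \<open>d ` A\<close> by shrinking \<open>U\<close> further,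
  so that every point of \<open>U\<close> is moved into \<open>V\<close> by some arrow in \<open>A\<close>.  If now \<open>\<eta>\<close> carries \<open>u \<in> U\<close>
  to \<open>\<eta> \<bullet> u \<in> U\<close>, choose \<open>\<alpha>, \<beta> \<in> A\<close> starting at the anchors of \<open>u\<close> and \<open>\<eta> \<bullet> u\<close>.  The arrow
  \<open>\<gamma> = \<beta> \<eta> \<alpha>\<inverse>\<close> carries \<open>\<alpha> \<bullet> u \<in> V\<close> to \<open>\<beta> \<bullet> (\<eta> \<bullet> u) \<in> V\<close>, hence \<open>\<gamma>\<close> lies in a fixed compact set \<open>C\<close>
  and \<open>\<eta> = \<beta>\<inverse> \<gamma> \<alpha>\<close> lies in \<open>K\<inverse> C K\<close>.  That set is compact because the composable pairs in a product
  of two compact sets form a closed subset of it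
  (\<open>compactin_arrow_product\<close>).
\<close>

context topological_groupoid
begin

text \<open>The source map is continuous since it can be written as \<open>\<xi> \<mapsto> \<xi>\<inverse> \<xi>\<close>.\<close>

lemma continuous_source: "continuous_map T T d"
proof -
  have "continuous_map T (prod_topology T T) (\<lambda>\<xi>. (ginv \<xi>, \<xi>))"
    using continuous_inv by (simp add: continuous_map_paired)
  then have "continuous_map T (subtopology (prod_topology T T) {(\<xi>, \<eta>). d \<xi> = r \<eta>}) (\<lambda>\<xi>. (ginv \<xi>, \<xi>))"
    by (auto simp: continuous_map_in_subtopology source_inv)
  from continuous_map_compose[OF this continuous_mult]
  show ?thesis
    by (rule continuous_map_eq) (simp add: mult_inv_left)
qed

lemma continuous_range: "continuous_map T T r"
  using continuous_map_compose[OF continuous_inv continuous_source]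
  by (rule continuous_map_eq) (simp add: source_inv)

definition arrow_product :: "'g set \<Rightarrow> 'g set \<Rightarrow> 'g set" where
  "arrow_product A B = {mult \<xi> \<eta> |\<xi> \<eta>. \<xi> \<in> A \<and> \<eta> \<in> B \<and> d \<xi> = r \<eta>}"

text \<open>
  Since \<open>d\<close> and \<open>r\<close> are continuous with values in a Hausdorff space, composability is a closed
  condition, so the composable pairs in \<open>A \<times> B\<close> are compact; \<open>arrow_product A B\<close> is their image
  under multiplication.
\<close>

lemma compactin_arrow_product:
  assumes A: "compactin T A" and B: "compactin T B"
  shows "compactin T (arrow_product A B)"
proof -
  let ?D = "{(\<xi>, \<eta>). d \<xi> = r \<eta>}"
  let ?P = "{p \<in> topspace (prod_topology T T). (d \<circ> fst) p = (r \<circ> snd) p}"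
  have "closedin (prod_topology T T) ?P"
    by (rule closedin_continuous_maps_eq[OF Hausdorff_groupoid])
      (rule continuous_map_compose[OF continuous_map_fst continuous_source]
        continuous_map_compose[OF continuous_map_snd continuous_range])+
  moreover have "compactin (prod_topology T T) (A \<times> B)"
    using A B by (simp add: compactin_Times)
  ultimately have "compactin (prod_topology T T) (?P \<inter> A \<times> B)"
    by (rule closed_Int_compactin)
  moreover have "?P \<inter> A \<times> B \<subseteq> ?D"
    by auto
  ultimately have "compactin (subtopology (prod_topology T T) ?D) (?P \<inter> A \<times> B)"
    by (simp add: compactin_subtopology)
  from image_compactin[OF this continuous_mult]
  have "compactin T ((\<lambda>(\<xi>, \<eta>). mult \<xi> \<eta>) ` (?P \<inter> A \<times> B))" .
  also have "(\<lambda>(\<xi>, \<eta>). mult \<xi> \<eta>) ` (?P \<inter> A \<times> B) = arrow_product A B"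
    using compactin_subset_topspace[OF A] compactin_subset_topspace[OF B]
    by (force simp: arrow_product_def image_iff)
  finally show ?thesis .
qed

lemma relatively_compact_subset_compact:
  assumes "compactin T C" "A \<subseteq> C"
  shows "relatively_compact A"
  unfolding relatively_compact_def
  using assms closure_of_minimal[of A C T] compactin_imp_closedin[OF Hausdorff_groupoid]
  by (metis closed_compactin closedin_closure_of)

end

context continuous_groupoid_action
begin

lemma action_closed:
  assumes "\<xi> \<in> topspace T" "\<sigma> \<in> topspace S" "d \<xi> = \<rho> \<sigma>"
  shows "\<theta> \<xi> \<sigma> \<in> topspace S"
  using continuous_map_image_subset_topspace[OF continuous_action] assms by force

text \<open>This is the compatibility axiom for the action, applied to the unit \<open>r \<eta>\<close> after \<open>\<eta>\<close>.\<close>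

lemma anchor_of_action:
  assumes "\<eta> \<in> topspace T" "\<sigma> \<in> topspace S" "d \<eta> = \<rho> \<sigma>"
  shows "\<rho> (\<theta> \<eta> \<sigma>) = r \<eta>"
  using anchor_action[of "r \<eta>" \<eta> \<sigma>] assms units_subset range_unit source_of_unit
  by (metis subsetD)

lemma mem_recurrence_set_iff:
  "\<eta> \<in> recurrence_set M N \<longleftrightarrow>
     \<eta> \<in> topspace T \<and> (\<exists>\<sigma>\<in>M. \<rho> \<sigma> = d \<eta> \<and> \<theta> \<eta> \<sigma> \<in> N)"
  by (auto simp: recurrence_set_def translate_def)

text \<open>
  Recurrence sets grow with the neighbourhood, so open witnesses suffice; compact sets of arrows
  are closed, so it is enough that some compact set contains the recurrence set.
\<close>

lemma wandering_iff:
  "wandering \<sigma> \<longleftrightarrow>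
     (\<exists>V C. openin S V \<and> \<sigma> \<in> V \<and> compactin T C \<and> recurrence_set V V \<subseteq> C)"
proof
  assume "wandering \<sigma>"
  then obtain W V where V: "openin S V" "\<sigma> \<in> V" "V \<subseteq> W"
    and W: "compactin T (T closure_of (recurrence_set W W))"
    unfolding wandering_def relatively_compact_def by blast
  have "recurrence_set V V \<subseteq> recurrence_set W W"
    using V(3) by (fastforce simp: mem_recurrence_set_iff)
  also have "\<dots> \<subseteq> T closure_of (recurrence_set W W)"
    by (rule closure_of_subset) (auto simp: recurrence_set_def)
  finally show "\<exists>V C. openin S V \<and> \<sigma> \<in> V \<and> compactin T C \<and> recurrence_set V V \<subseteq> C"
    using V W by blast
next
  assume "\<exists>V C. openin S V \<and> \<sigma> \<in> V \<and> compactin T C \<and> recurrence_set V V \<subseteq> C"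
  then show "wandering \<sigma>"
    unfolding wandering_def by (meson openin_subset order_refl relatively_compact_subset_compact)
qed

lemma closedin_nonwandering_set: "closedin S nonwandering_set"
proof -
  have "openin S {\<sigma> \<in> topspace S. wandering \<sigma>}"
    by (subst openin_subopen) (use openin_subset in \<open>fastforce simp: wandering_iff\<close>)
  moreover have "topspace S - nonwandering_set = {\<sigma> \<in> topspace S. wandering \<sigma>}"
    by (auto simp: nonwandering_set_def)
  ultimately show ?thesis
    by (auto simp: closedin_def nonwandering_set_def)
qed

lemma action_neighbourhoods:
  assumes \<xi>: "\<xi> \<in> topspace T" and \<sigma>: "\<sigma> \<in> topspace S" and eq: "d \<xi> = \<rho> \<sigma>"
    and V: "openin S V" "\<theta> \<xi> \<sigma> \<in> V"
  obtains A U where "openin T A" "\<xi> \<in> A" "openin S U" "\<sigma> \<in> U"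
    "\<And>\<alpha> u. \<alpha> \<in> A \<Longrightarrow> u \<in> U \<Longrightarrow> d \<alpha> = \<rho> u \<Longrightarrow> \<theta> \<alpha> u \<in> V"
proof -
  let ?D = "{(\<xi>, \<sigma>). d \<xi> = \<rho> \<sigma>}"
  let ?Q = "{p \<in> topspace (subtopology (prod_topology T S) ?D). (\<lambda>(\<xi>, \<sigma>). \<theta> \<xi> \<sigma>) p \<in> V}"
  have "openin (subtopology (prod_topology T S) ?D) ?Q"
    using continuous_action V(1) by (rule openin_continuous_map_preimage)
  then obtain R where R: "openin (prod_topology T S) R" "?Q = R \<inter> ?D"
    by (auto simp: openin_subtopology)
  have "(\<xi>, \<sigma>) \<in> ?Q"
    using \<xi> \<sigma> eq V(2) by simp
  then have "(\<xi>, \<sigma>) \<in> R"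
    using R(2) by blast
  then obtain A U where AU: "openin T A" "\<xi> \<in> A" "openin S U" "\<sigma> \<in> U" "A \<times> U \<subseteq> R"
    using R(1) unfolding openin_prod_topology_alt by meson
  have "\<theta> \<alpha> u \<in> V" if "\<alpha> \<in> A" "u \<in> U" "d \<alpha> = \<rho> u" for \<alpha> u
  proof -
    have "(\<alpha>, u) \<in> R \<inter> ?D"
      using that AU(5) by auto
    then have "(\<alpha>, u) \<in> ?Q"
      using R(2) by blast
    then show ?thesis by simp
  qed
  with AU that show thesis by blast
qed

text \<open>Conjugation: the recurrence of \<open>u\<close> under \<open>\<eta>\<close> becomes that of \<open>\<theta> \<alpha> u\<close> under \<open>\<beta> \<eta> \<alpha>\<inverse>\<close>.\<close>

lemma conjugate_recurrence:
  assumes T: "\<alpha> \<in> topspace T" "\<beta> \<in> topspace T" "\<eta> \<in> topspace T" and u: "u \<in> topspace S"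
    and eq: "d \<eta> = \<rho> u" "d \<alpha> = \<rho> u" "d \<beta> = r \<eta>"
    and V: "\<theta> \<alpha> u \<in> V" "\<theta> \<beta> (\<theta> \<eta> u) \<in> V"
  defines "\<gamma> \<equiv> mult (mult \<beta> \<eta>) (ginv \<alpha>)"
  shows "\<gamma> \<in> recurrence_set V V"
    and "\<eta> = mult (ginv \<beta>) (mult \<gamma> \<alpha>)"
    and "d \<gamma> = r \<alpha>" and "r (mult \<gamma> \<alpha>) = r \<beta>"
proof -
  note c = T source_inv range_inv inv_closed source_mult range_mult mult_closed eq
  have \<beta>\<eta>: "mult \<beta> \<eta> \<in> topspace T" "d (mult \<beta> \<eta>) = d \<alpha>"
    by (simp_all add: c)
  have \<gamma>: "\<gamma> \<in> topspace T"
    using \<beta>\<eta> by (simp add: \<gamma>_def c)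
  show d\<gamma>: "d \<gamma> = r \<alpha>"
    using \<beta>\<eta> by (simp add: \<gamma>_def c)
  have "mult \<gamma> \<alpha> = mult (mult \<beta> \<eta>) (mult (ginv \<alpha>) \<alpha>)"
    unfolding \<gamma>_def using \<beta>\<eta> by (intro mult_assoc) (simp_all add: c)
  also have "\<dots> = mult \<beta> \<eta>"
    using \<beta>\<eta> T mult_inv_left mult_right_unit by metis
  finally have \<gamma>\<alpha>: "mult \<gamma> \<alpha> = mult \<beta> \<eta>" .
  show "r (mult \<gamma> \<alpha>) = r \<beta>"
    by (simp add: \<gamma>\<alpha> c)
  have "mult (ginv \<beta>) (mult \<beta> \<eta>) = mult (mult (ginv \<beta>) \<beta>) \<eta>"
    by (rule mult_assoc[symmetric]) (simp_all add: c)
  also have "\<dots> = \<eta>"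
    using T eq mult_inv_left mult_left_unit by metis
  finally show "\<eta> = mult (ginv \<beta>) (mult \<gamma> \<alpha>)"
    by (simp add: \<gamma>\<alpha>)
  have "\<theta> \<gamma> (\<theta> \<alpha> u) = \<theta> (mult \<gamma> \<alpha>) u"
    using T u eq \<gamma> d\<gamma> by (simp add: action_mult)
  also have "\<dots> = \<theta> \<beta> (\<theta> \<eta> u)"
    using T u eq by (simp add: \<gamma>\<alpha> action_mult)
  finally show "\<gamma> \<in> recurrence_set V V"
    using V \<gamma> d\<gamma> T u eq
    by (auto simp: mem_recurrence_set_iff anchor_of_action intro!: bexI[of _ "\<theta> \<alpha> u"])
qed

text \<open>
  Openness of \<open>d\<close> is what allows both \<open>u\<close> and \<open>\<eta> \<bullet> u\<close> to be pushed into \<open>V\<close> by arrows near \<open>\<xi>\<close>: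
  nearby units must be sources of arrows near \<open>\<xi>\<close>.  Local compactness keeps these correcting
  arrows in a compact set.
\<close>

lemma wandering_translate_imp_wandering:
  assumes op: open_groupoid and lc: "locally_compact_space T"
    and \<xi>: "\<xi> \<in> topspace T" and \<sigma>: "\<sigma> \<in> topspace S" and eq: "d \<xi> = \<rho> \<sigma>"
    and wand: "wandering (\<theta> \<xi> \<sigma>)"
  shows "wandering \<sigma>"
proof -
  obtain V C where V: "openin S V" "\<theta> \<xi> \<sigma> \<in> V"
    and C: "compactin T C" "recurrence_set V V \<subseteq> C"
    using wand by (auto simp: wandering_iff)
  obtain A1 U where A1: "openin T A1" "\<xi> \<in> A1" and U: "openin S U" "\<sigma> \<in> U"
    and act: "\<And>\<alpha> u. \<alpha> \<in> A1 \<Longrightarrow> u \<in> U \<Longrightarrow> d \<alpha> = \<rho> u \<Longrightarrow> \<theta> \<alpha> u \<in> V"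
    using action_neighbourhoods[OF \<xi> \<sigma> eq V] by metis
  obtain A2 K where A2: "openin T A2" "\<xi> \<in> A2" and K: "compactin T K" "A2 \<subseteq> K"
    using lc \<xi> unfolding locally_compact_space_def by meson
  define A where "A = A1 \<inter> A2"
  have A: "openin T A" "\<xi> \<in> A" "A \<subseteq> topspace T"
    using A1 A2 openin_subset by (auto simp: A_def)
  \<comment> \<open>The points of \<open>U\<close> on which some arrow in \<open>A\<close> can act.\<close>
  define U' where "U' = {u \<in> topspace S. \<rho> u \<in> d ` A} \<inter> U"
  have "openin (subtopology T X) (d ` A)"
    using op A(1) by (simp add: open_groupoid_def open_map_def)
  then have "openin S {u \<in> topspace S. \<rho> u \<in> d ` A}"
    using continuous_anchor by (rule openin_continuous_map_preimage[rotated])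
  then have U': "openin S U'" "\<sigma> \<in> U'"
    using U A(2) \<sigma> by (auto simp: U'_def simp flip: eq)
  let ?L = "arrow_product (ginv ` K) (arrow_product C K)"
  have "recurrence_set U' U' \<subseteq> ?L"
  proof
    fix \<eta> assume "\<eta> \<in> recurrence_set U' U'"
    then obtain u where \<eta>: "\<eta> \<in> topspace T" and u: "u \<in> U'" "\<theta> \<eta> u \<in> U'" and e: "d \<eta> = \<rho> u"
      by (auto simp: mem_recurrence_set_iff)
    have uS: "u \<in> topspace S"
      using u by (simp add: U'_def)
    obtain \<alpha> \<beta> where \<alpha>: "\<alpha> \<in> A" "d \<alpha> = \<rho> u" and \<beta>: "\<beta> \<in> A" "d \<beta> = \<rho> (\<theta> \<eta> u)"
      using u by (auto simp: U'_def)
    have \<beta>r: "d \<beta> = r \<eta>"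
      using \<beta>(2) anchor_of_action[OF \<eta> uS e] by simp
    have V': "\<theta> \<alpha> u \<in> V" "\<theta> \<beta> (\<theta> \<eta> u) \<in> V"
      using \<alpha> \<beta> u by (auto simp: A_def U'_def intro: act)
    have T: "\<alpha> \<in> topspace T" "\<beta> \<in> topspace T"
      using \<alpha> \<beta> A(3) by auto
    note conj = conjugate_recurrence[OF T \<eta> uS e \<alpha>(2) \<beta>r V']
    let ?\<gamma> = "mult (mult \<beta> \<eta>) (ginv \<alpha>)"
    have "\<alpha> \<in> K" "\<beta> \<in> K"
      using \<alpha> \<beta> K(2) by (auto simp: A_def)
    then have "mult ?\<gamma> \<alpha> \<in> arrow_product C K"
      unfolding arrow_product_def using conj(1,3) C(2) by blast
    moreover have "d (ginv \<beta>) = r (mult ?\<gamma> \<alpha>)"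
      using conj(4) T by (simp add: source_inv)
    ultimately have "mult (ginv \<beta>) (mult ?\<gamma> \<alpha>) \<in> ?L"
      unfolding arrow_product_def[of "ginv ` K"] using \<open>\<beta> \<in> K\<close> by blast
    then show "\<eta> \<in> ?L"
      by (simp flip: conj(2))
  qed
  moreover have "compactin T ?L"
    using K(1) C(1) continuous_inv by (intro compactin_arrow_product image_compactin)
  ultimately show ?thesis
    using U' by (auto simp: wandering_iff)
qed

lemma invariant_nonwandering_set:
  assumes open_groupoid "locally_compact_space T"
  shows "invariant nonwandering_set"
  using wandering_translate_imp_wandering[OF assms] action_closed
  by (auto simp: invariant_def translate_def nonwandering_set_def)

end

theorem proposition5p13:
  fixes T :: "'g topology" and X :: "'g set"
    and d r :: "'g \<Rightarrow> 'g" and mult :: "'g \<Rightarrow> 'g \<Rightarrow> 'g" and ginv :: "'g \<Rightarrow> 'g"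
    and \<rho> :: "'s \<Rightarrow> 'g" and \<theta> :: "'g \<Rightarrow> 's \<Rightarrow> 's" and S :: "'s topology"
  assumes "continuous_groupoid_action T X d r mult ginv \<rho> \<theta> S"
    and "topological_groupoid.strongly_noncompact T X d"
  shows "closedin S (continuous_groupoid_action.nonwandering_set T d \<rho> \<theta> S) \<and>
    (topological_groupoid.open_groupoid T X d \<and> locally_compact_space T \<longrightarrow>
       continuous_groupoid_action.invariant T d \<rho> \<theta>
         (continuous_groupoid_action.nonwandering_set T d \<rho> \<theta> S))"
proof -
  interpret continuous_groupoid_action T X d r mult ginv \<rho> \<theta> S
    by fact
  show ?thesis
    using closedin_nonwandering_set invariant_nonwandering_set by blast
qed

end
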